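(* Let $\{\widehat{\alpha}_h\}_{h\in H}$ be an expanding family of automorphisms of $\widehat{G}$. Then, for every closed cocompact subgroup $\Gamma$ of $G$, the family $\{\widehat{\alpha}_h\}_{h\in H}$ has Property X for $\Gamma^\perp$.
   Context: $G$ is a locally compact second countable abelian group with Haar measure $\mu_G$; $\widehat{G}$ is its dual group with identity $\mathrm{e}$, pairing $\langle\xi,x\rangle\in\mathbb{T}$, and Haar measure $\nu_{\widehat{G}}$ (normalized so that the Fourier transform is unitary from $L^2(G)$ to $L^2(\widehat{G})$). For a closed cocompact subgroup $\Gamma$ of $G$, $\Gamma^\perp=\{\lambda\in\widehat{G}:\langle\lambda,\gamma\rangle=1\ \forall\gamma\in\Gamma\}$ is its annihilator, a discrete countable subgroup of $\widehat{G}$. $\widehat{G}$ carries a translation-invariant metric $d_{\widehat{G}}$ inducing its topology, whose closed balls are compact, with open balls $B(\xi_0,r)$, and which is weakly doubling: there are $r_0>0$, $C>0$ with $\nu_{\widehat{G}}(B(\mathrm{e},2r))\le C\,\nu_{\widehat{G}}(B(\mathrm{e},r))$ for all $r<r_0$. $\varsigma$ is a $\sigma$-finite Borel measure on $H$, and $\alpha:H\to\mathrm{Aut}(G)$ is such that $(x,h)\mapsto\alpha_h(x)$ is measurable on $(G,\mu_G)\times(H,\varsigma)$. $\delta:H\to\mathbb{R}^+$ is the measurable function with $\int_G f(\alpha_h(x))\,d\mu_G(x)=\delta(h)\int_G f\,d\mu_G$ for $f\in L^1(G)$. The dual automorphism $\widehat{\alpha}_h\in\mathrm{Aut}(\widehat{G})$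 is defined by $\langle\widehat{\alpha}_h(\xi),x\rangle=\langle\xi,\alpha_h^{-1}(x)\rangle$ (so $\nu_{\widehat{G}}(\widehat{\alpha}_hB(\xi_0,r))=\delta(h)\nu_{\widehat{G}}(B(\xi_0,r))$). The family $\{\widehat{\alpha}_h\}$ is measurably bi-Lipschitz with constants $\ell,L$ if $\ell,L:H\to\mathbb{R}^+$ are $\varsigma$-measurable and $\ell(h)d_{\widehat{G}}(\xi,\mathrm{e})\le d_{\widehat{G}}(\widehat{\alpha}_h(\xi),\mathrm{e})\le L(h)d_{\widehat{G}}(\xi,\mathrm{e})$ for all $\xi\in\widehat{G}$, $h\in H$. A measurably bi-Lipschitz family with constants $\ell,L$ is expanding if there exist $M_0,N_0>0$ such that for all $M>M_0$ and $h\in H$: $L(h)>M\Rightarrow\ell(h)>N_0$. Property X for $\Gamma^\perp$: there exist $r>0$, $M>0$, $C>0$ such that $\sharp(\Gamma^\perp\cap\widehat{\alpha}_hB(\mathrm{e},r))\le 1+C\,\delta(h)$ for all $h\in H$ with $L(h)>M$. *)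

theory Defs
  imports "HOL-Analysis.Analysis"
begin

text \<open>The group law of \<open>G\<close> is written additively. The unit circle is the set of complex numbers
  of modulus 1. The dual group is also written additively, so that its identity is \<open>0\<close>.\<close>

typedef (overloaded) ('g :: topological_ab_group_add) dual =
  "{\<phi> :: 'g \<Rightarrow> complex.
      continuous_on UNIV \<phi> \<and> (\<forall>x. cmod (\<phi> x) = 1) \<and> (\<forall>x y. \<phi> (x + y) = \<phi> x * \<phi> y)}"
  morphisms pairing Abs_dual
  by (rule exI[of _ "\<lambda>_. 1"]) auto

lemma continuous_pairing: "continuous_on UNIV (pairing \<xi>)"
  using pairing[of \<xi>] by auto

lemma cmod_pairing [simp]: "cmod (pairing \<xi> x) = 1"
  using pairing[of \<xi>] by auto

lemma pairing_add_right: "pairing \<xi> (x + y) = pairing \<xi> x * pairing \<xi> y"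
  using pairing[of \<xi>] by auto

instantiation dual :: (topological_ab_group_add) ab_group_add
begin

definition zero_dual :: "'a dual"
  where "0 = Abs_dual (\<lambda>_. 1)"

definition plus_dual :: "'a dual \<Rightarrow> 'a dual \<Rightarrow> 'a dual"
  where "\<xi> + \<eta> = Abs_dual (\<lambda>x. pairing \<xi> x * pairing \<eta> x)"

definition uminus_dual :: "'a dual \<Rightarrow> 'a dual"
  where "- \<xi> = Abs_dual (\<lambda>x. cnj (pairing \<xi> x))"

definition minus_dual :: "'a dual \<Rightarrow> 'a dual \<Rightarrow> 'a dual"
  where "\<xi> - \<eta> = \<xi> + - \<eta>" for \<xi> \<eta> :: "'a dual"

lemma pairing_zero [simp]: "pairing 0 x = 1"
  by (simp add: zero_dual_def Abs_dual_inverse)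

lemma pairing_plus: "pairing (\<xi> + \<eta>) x = pairing \<xi> x * pairing \<eta> x"
  unfolding plus_dual_def
  by (subst Abs_dual_inverse)
    (auto simp: norm_mult pairing_add_right intro!: continuous_intros continuous_pairing)

lemma pairing_uminus: "pairing (- \<xi>) x = cnj (pairing \<xi> x)"
  unfolding uminus_dual_def
  by (subst Abs_dual_inverse)
    (auto simp: pairing_add_right intro!: continuous_intros continuous_pairing)

instance
proof
  fix a b c :: "'a dual"
  show "a + b + c = a + (b + c)"
    by (simp add: pairing_inject[symmetric] fun_eq_iff pairing_plus)
  show "a + b = b + a"
    by (simp add: pairing_inject[symmetric] fun_eq_iff pairing_plus)
  show "0 + a = a"
    by (simp add: pairing_inject[symmetric] fun_eq_iff pairing_plus)
  have "cnj (pairing a x) * pairing a x = 1" for x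
    using complex_norm_square[of "pairing a x"] by (simp add: mult.commute)
  then show "- a + a = 0"
    by (simp add: pairing_inject[symmetric] fun_eq_iff pairing_plus pairing_uminus)
  show "a - b = a + - b"
    by (rule minus_dual_def)
qed

end

text \<open>The dual group carries the compact-open topology.\<close>

instantiation dual :: (topological_ab_group_add) topological_space
begin

definition open_dual :: "'a dual set \<Rightarrow> bool"
  where "open_dual =
    generate_topology {{\<xi>. pairing \<xi> ` K \<subseteq> U} | K U. compact K \<and> open U}"

instance
  by standard
    (auto simp: open_dual_def
      intro: generate_topology.UNIV generate_topology.Int generate_topology.UN)

end

text \<open>On a second countable locally compact group every such measure is automatically regular.\<close>

definition haar_measure :: "'g :: {topological_space, ab_group_add} measure \<Rightarrow> bool"
  where "haar_measure \<mu> \<longleftrightarrow>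
    sets \<mu> = sets borel \<and>
    (\<forall>K. compact K \<longrightarrow> emeasure \<mu> K < \<infinity>) \<and>
    (\<forall>x. \<forall>A \<in> sets borel. emeasure \<mu> ((+) x ` A) = emeasure \<mu> A) \<and>
    emeasure \<mu> UNIV \<noteq> 0"

definition fourier ::
    "'g :: topological_ab_group_add measure \<Rightarrow> ('g \<Rightarrow> complex) \<Rightarrow> 'g dual \<Rightarrow> complex"
  where "fourier \<mu> f \<xi> = (LINT x|\<mu>. f x * cnj (pairing \<xi> x))"

definition square_integrable :: "'a measure \<Rightarrow> ('a \<Rightarrow> complex) \<Rightarrow> bool"
  where "square_integrable M f \<longleftrightarrow>
    f \<in> borel_measurable M \<and> integrable M (\<lambda>x. (cmod (f x))\<^sup>2)"

text \<open>The Fourier transform is given by the integral formula on the intersection of \<open>L\<^sup>1\<close> and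
  \<open>L\<^sup>2\<close>, which is dense in \<open>L\<^sup>2\<close>. It extends to a unitary operator between the \<open>L\<^sup>2\<close>-spaces iff it
  is isometric there and has dense range.\<close>

definition fourier_unitary ::
    "'g :: topological_ab_group_add measure \<Rightarrow> 'g dual measure \<Rightarrow> bool"
  where "fourier_unitary \<mu> \<nu> \<longleftrightarrow>
    (\<forall>f. integrable \<mu> f \<and> square_integrable \<mu> f \<longrightarrow>
      square_integrable \<nu> (fourier \<mu> f) \<and>
      (LINT \<xi>|\<nu>. (cmod (fourier \<mu> f \<xi>))\<^sup>2) = (LINT x|\<mu>. (cmod (f x))\<^sup>2)) \<and>
    (\<forall>g. square_integrable \<nu> g \<longrightarrow>
      (\<forall>\<epsilon>>0. \<exists>f. integrable \<mu> f \<and> square_integrable \<mu> f \<and>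
        (LINT \<xi>|\<nu>. (cmod (fourier \<mu> f \<xi> - g \<xi>))\<^sup>2) < \<epsilon>))"

definition closed_subgroup :: "'g :: {topological_space, ab_group_add} set \<Rightarrow> bool"
  where "closed_subgroup \<Gamma> \<longleftrightarrow> closed \<Gamma> \<and> 0 \<in> \<Gamma> \<and> (\<forall>x\<in>\<Gamma>. \<forall>y\<in>\<Gamma>. x - y \<in> \<Gamma>)"

definition coset :: "'g :: ab_group_add set \<Rightarrow> 'g \<Rightarrow> 'g set"
  where "coset \<Gamma> x = (+) x ` \<Gamma>"

definition quotient_group_topology ::
    "'g :: {topological_space, ab_group_add} set \<Rightarrow> 'g set topology"
  where "quotient_group_topology \<Gamma> =
    topology (\<lambda>\<U>. \<U> \<subseteq> range (coset \<Gamma>) \<and> open (coset \<Gamma> -` \<U>))"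

lemma openin_quotient_group_topology:
  "openin (quotient_group_topology \<Gamma>) \<U> \<longleftrightarrow> \<U> \<subseteq> range (coset \<Gamma>) \<and> open (coset \<Gamma> -` \<U>)"
proof -
  have "istopology (\<lambda>\<U>. \<U> \<subseteq> range (coset \<Gamma>) \<and> open (coset \<Gamma> -` \<U>))"
    unfolding istopology_def by (auto simp: vimage_Union)
  then show ?thesis
    by (simp add: quotient_group_topology_def)
qed

lemma topspace_quotient_group_topology:
  "topspace (quotient_group_topology \<Gamma>) = range (coset \<Gamma>)"
proof -
  have "coset \<Gamma> -` range (coset \<Gamma>) = UNIV"
    by auto
  then have "openin (quotient_group_topology \<Gamma>) (range (coset \<Gamma>))"
    by (simp add: openin_quotient_group_topology)
  then show ?thesis
    by (auto simp: topspace_def openin_quotient_group_topology)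
qed

lemma quotient_map_coset: "quotient_map euclidean (quotient_group_topology \<Gamma>) (coset \<Gamma>)"
  by (simp add: quotient_map_def topspace_quotient_group_topology
      openin_quotient_group_topology vimage_def)

definition cocompact :: "'g :: {topological_space, ab_group_add} set \<Rightarrow> bool"
  where "cocompact \<Gamma> \<longleftrightarrow> compact_space (quotient_group_topology \<Gamma>)"

definition annihilator :: "'g :: topological_ab_group_add set \<Rightarrow> 'g dual set"
  where "annihilator \<Gamma> = {\<xi>. \<forall>\<gamma>\<in>\<Gamma>. pairing \<xi> \<gamma> = 1}"

definition proper_invariant_metric ::
    "('a :: {topological_space, ab_group_add} \<Rightarrow> 'a \<Rightarrow> real) \<Rightarrow> bool"
  where "proper_invariant_metric d \<longleftrightarrow>
    Metric_space UNIV d \<and>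
    Metric_space.mtopology UNIV d = euclidean \<and>
    (\<forall>\<xi> \<eta> \<zeta>. d (\<zeta> + \<xi>) (\<zeta> + \<eta>) = d \<xi> \<eta>) \<and>
    (\<forall>\<xi> r. compact (Metric_space.mcball UNIV d \<xi> r))"

definition weakly_doubling ::
    "('a :: ab_group_add \<Rightarrow> 'a \<Rightarrow> real) \<Rightarrow> 'a measure \<Rightarrow> bool"
  where "weakly_doubling d \<nu> \<longleftrightarrow>
    (\<exists>r\<^sub>0>0. \<exists>C>0. \<forall>r<r\<^sub>0.
      emeasure \<nu> (Metric_space.mball UNIV d 0 (2 * r)) \<le>
        ennreal C * emeasure \<nu> (Metric_space.mball UNIV d 0 r))"

definition group_aut :: "('g :: topological_ab_group_add \<Rightarrow> 'g) set"
  where "group_aut = {a. (\<forall>x y. a (x + y) = a x + a y) \<and> bij a \<and> homeomorphism UNIV UNIV a (inv a)}"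

definition dual_aut :: "('g :: topological_ab_group_add \<Rightarrow> 'g) \<Rightarrow> 'g dual \<Rightarrow> 'g dual"
  where "dual_aut a \<xi> = Abs_dual (\<lambda>x. pairing \<xi> (inv a x))"

lemma pairing_dual_aut:
  assumes "a \<in> group_aut"
  shows "pairing (dual_aut a \<xi>) x = pairing \<xi> (inv a x)"
proof -
  have a: "\<forall>x y. a (x + y) = a x + a y" "bij a" "continuous_on UNIV (inv a)"
    using assms by (auto simp: group_aut_def homeomorphism_def)
  have "inv a (x + y) = inv a x + inv a y" for x y
  proof -
    have "a (inv a x + inv a y) = x + y"
      using a by (simp add: bij_is_surj surj_f_inv_f)
    then show ?thesis
      using a(2) by (metis bij_inv_eq_iff)
  qed
  moreover have "continuous_on UNIV (\<lambda>x. pairing \<xi> (inv a x))"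
    by (rule continuous_on_compose2[OF continuous_pairing a(3)]) auto
  ultimately show ?thesis
    unfolding dual_aut_def by (subst Abs_dual_inverse) (auto simp: pairing_add_right)
qed

definition measurably_bi_lipschitz ::
    "'h measure \<Rightarrow> ('a :: ab_group_add \<Rightarrow> 'a \<Rightarrow> real) \<Rightarrow> ('h \<Rightarrow> 'a \<Rightarrow> 'a) \<Rightarrow>
      ('h \<Rightarrow> real) \<Rightarrow> ('h \<Rightarrow> real) \<Rightarrow> bool"
  where "measurably_bi_lipschitz \<sigma> d \<beta> l L \<longleftrightarrow>
    l \<in> borel_measurable \<sigma> \<and> L \<in> borel_measurable \<sigma> \<and>
    (\<forall>h. l h > 0 \<and> L h > 0) \<and>
    (\<forall>\<xi> h. l h * d \<xi> 0 \<le> d (\<beta> h \<xi>) 0 \<and> d (\<beta> h \<xi>) 0 \<le> L h * d \<xi> 0)"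

definition expanding ::
    "'h measure \<Rightarrow> ('a :: ab_group_add \<Rightarrow> 'a \<Rightarrow> real) \<Rightarrow> ('h \<Rightarrow> 'a \<Rightarrow> 'a) \<Rightarrow>
      ('h \<Rightarrow> real) \<Rightarrow> ('h \<Rightarrow> real) \<Rightarrow> bool"
  where "expanding \<sigma> d \<beta> l L \<longleftrightarrow>
    measurably_bi_lipschitz \<sigma> d \<beta> l L \<and>
    (\<exists>M\<^sub>0>0. \<exists>N\<^sub>0>0. \<forall>M>M\<^sub>0. \<forall>h. L h > M \<longrightarrow> l h > N\<^sub>0)"

definition property_X ::
    "('a :: ab_group_add \<Rightarrow> 'a \<Rightarrow> real) \<Rightarrow> ('h \<Rightarrow> 'a \<Rightarrow> 'a) \<Rightarrow>
      ('h \<Rightarrow> real) \<Rightarrow> ('h \<Rightarrow> real) \<Rightarrow> 'a set \<Rightarrow> bool"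
  where "property_X d \<beta> \<delta> L \<Lambda> \<longleftrightarrow>
    (\<exists>r>0. \<exists>M>0. \<exists>C>0. \<forall>h. L h > M \<longrightarrow>
      finite (\<Lambda> \<inter> \<beta> h ` Metric_space.mball UNIV d 0 r) \<and>
      real (card (\<Lambda> \<inter> \<beta> h ` Metric_space.mball UNIV d 0 r)) \<le> 1 + C * \<delta> h)"

end

theory Submission
  imports Defs
begin

text \<open>Let \<open>K\<close> be a compact set of positive measure in \<open>G\<close>. If \<open>r\<close> is small, every \<open>\<eta>\<close> in the
  ball of radius \<open>2r\<close> of the dual has real part at least \<open>1/2\<close> on \<open>K\<close>, so that on the image of this ball
  under the dual of \<open>\<alpha>\<^sub>h\<close> the Fourier transform of the indicator of \<open>\<alpha>\<^sub>h K\<close> has modulus at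
  least \<open>\<mu>(\<alpha>\<^sub>h K)/2\<close>. By Plancherel and Markov's inequality this image has measure at most
  \<open>4/\<mu>(\<alpha>\<^sub>h K) = 4 \<delta>(h)/\<mu>(K)\<close>. On the other hand, since \<open>l(h)\<close> is bounded below, the image
  contains the balls of a fixed radius \<open>t\<close> around all annihilator points in the image of the ball of
  radius \<open>r\<close>. The annihilator is discrete, so these balls are disjoint for small \<open>t\<close>. Comparing
  volumes bounds the number of points by a multiple of \<open>\<delta>(h)\<close>.\<close>

section \<open>Discreteness of the annihilator\<close>

text \<open>The coset map is open, so open sets lying inside compact ones have images that form an
  open cover of the compact quotient. The compact sets belonging to a finite subcover together meet
  every coset.\<close>

lemma compact_transversal:
  fixes \<Gamma> :: "'g :: topological_ab_group_add set"
  assumes lc: "locally_compact_space (euclidean :: 'g topology)"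
    and \<Gamma>: "closed_subgroup \<Gamma>" and cc: "cocompact \<Gamma>"
  obtains K where "compact K" and "\<And>x. \<exists>k\<in>K. x - k \<in> \<Gamma>"
proof -
  have "\<forall>x::'g. \<exists>U K. open U \<and> compact K \<and> x \<in> U \<and> U \<subseteq> K"
    using lc by (simp add: locally_compact_space_def)
  then obtain U K where UK: "\<And>x::'g. open (U x)" "\<And>x. compact (K x)" "\<And>x. x \<in> U x"
    "\<And>x. U x \<subseteq> K x"
    by metis
  have sub: "0 \<in> \<Gamma>" "\<And>x y. x \<in> \<Gamma> \<Longrightarrow> y \<in> \<Gamma> \<Longrightarrow> x - y \<in> \<Gamma>"
    using \<Gamma> by (auto simp: closed_subgroup_def)
  have neg: "- x \<in> \<Gamma>" if "x \<in> \<Gamma>" for x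
    using sub(2)[OF sub(1) that] by simp
  have add: "x + y \<in> \<Gamma>" if "x \<in> \<Gamma>" "y \<in> \<Gamma>" for x y
    using sub(2)[OF that(1) neg[OF that(2)]] by simp
  have coset_mem: "y \<in> coset \<Gamma> x \<longleftrightarrow> y - x \<in> \<Gamma>" for x y
    unfolding coset_def by (metis add.commute diff_add_cancel image_iff add_diff_cancel_left')
  have coset_eq: "coset \<Gamma> x = coset \<Gamma> y \<longleftrightarrow> x - y \<in> \<Gamma>" for x y
  proof
    assume "coset \<Gamma> x = coset \<Gamma> y"
    then show "x - y \<in> \<Gamma>"
      using coset_mem[of x x] coset_mem[of x y] sub(1) by simp
  next
    assume xy: "x - y \<in> \<Gamma>"
    have "z - x \<in> \<Gamma> \<longleftrightarrow> z - y \<in> \<Gamma>" for z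
      using add[OF xy, of "z - x"] sub(2)[OF _ xy, of "z - y"] by auto
    then show "coset \<Gamma> x = coset \<Gamma> y"
      using coset_mem by blast
  qed
  have "openin (quotient_group_topology \<Gamma>) (coset \<Gamma> ` U x)" for x
  proof -
    \<comment> \<open>Openness of the coset map: the saturation of \<open>U x\<close> is the union
      of its translates by elements of \<Gamma>.\<close>
    have "coset \<Gamma> -` (coset \<Gamma> ` U x) = (\<Union>\<gamma>\<in>\<Gamma>. (\<lambda>z. z - \<gamma>) -` U x)"
    proof (intro set_eqI iffI)
      fix z assume "z \<in> coset \<Gamma> -` (coset \<Gamma> ` U x)"
      then obtain u where "u \<in> U x" "z - u \<in> \<Gamma>"
        using coset_eq by auto
      then show "z \<in> (\<Union>\<gamma>\<in>\<Gamma>. (\<lambda>z. z - \<gamma>) -` U x)"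
        by (intro UN_I[of "z - u"]) auto
    next
      fix z assume "z \<in> (\<Union>\<gamma>\<in>\<Gamma>. (\<lambda>z. z - \<gamma>) -` U x)"
      then obtain \<gamma> where "\<gamma> \<in> \<Gamma>" "z - \<gamma> \<in> U x"
        by auto
      moreover have "coset \<Gamma> z = coset \<Gamma> (z - \<gamma>)"
        using \<open>\<gamma> \<in> \<Gamma>\<close> by (simp add: coset_eq)
      ultimately show "z \<in> coset \<Gamma> -` (coset \<Gamma> ` U x)"
        by auto
    qed
    moreover have "open ((\<lambda>z. z - \<gamma>) -` U x)" for \<gamma>
      by (intro open_vimage UK continuous_intros)
    ultimately show ?thesis
      by (auto simp: openin_quotient_group_topology)
  qed
  moreover have "topspace (quotient_group_topology \<Gamma>) \<subseteq> \<Union>(range (\<lambda>x. coset \<Gamma> ` U x))"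
    using UK(3) by (auto simp: topspace_quotient_group_topology)
  ultimately obtain \<F> where "finite \<F>" "\<F> \<subseteq> range (\<lambda>x. coset \<Gamma> ` U x)"
      "topspace (quotient_group_topology \<Gamma>) \<subseteq> \<Union>\<F>"
    using cc unfolding cocompact_def compact_space_alt
    by (metis (no_types, lifting) imageE)
  then obtain X where X: "finite X" "range (coset \<Gamma>) \<subseteq> (\<Union>x\<in>X. coset \<Gamma> ` U x)"
    using finite_subset_image[of \<F> "\<lambda>x. coset \<Gamma> ` U x" UNIV]
    by (auto simp: topspace_quotient_group_topology)
  show thesis
  proof
    show "compact (\<Union>x\<in>X. K x)"
      using X(1) UK(2) by auto
  next
    fix x
    have "coset \<Gamma> x \<in> (\<Union>x\<in>X. coset \<Gamma> ` U x)"
      using X(2) by blast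
    then show "\<exists>k\<in>\<Union>x\<in>X. K x. x - k \<in> \<Gamma>"
      unfolding UN_iff image_iff using coset_eq UK(4) by (metis UN_I subsetD)
  qed
qed

text \<open>The circle has no small subgroups: repeated doubling drives every value other than 1 out
  of the open right half.\<close>

lemma dual_eq_zero_if_Re_pos:
  assumes pos: "\<And>x. Re (pairing \<xi> x) > 0"
  shows "\<xi> = 0"
proof -
  have sq: "(Re (pairing \<xi> x))\<^sup>2 + (Im (pairing \<xi> x))\<^sup>2 = 1" for x
    using cmod_power2[of "pairing \<xi> x"] by simp
  \<comment> \<open>Doubling the argument at least doubles the defect \<open>1 - Re\<close>, which stays below 1.\<close>
  have double: "2 * (1 - Re (pairing \<xi> x)) \<le> 1 - Re (pairing \<xi> (x + x))" for x
  proof -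
    define c where "c = Re (pairing \<xi> x)"
    have c: "0 < c" "c\<^sup>2 + (Im (pairing \<xi> x))\<^sup>2 = 1"
      using pos sq by (auto simp: c_def)
    then have "c\<^sup>2 \<le> 1\<^sup>2"
      by (metis le_add_same_cancel1 power_one zero_le_power2)
    then have "c \<le> 1"
      by (rule power2_le_imp_le) simp
    then have "c * c \<le> c * 1"
      using c(1) by (intro mult_left_mono) auto
    \<comment> \<open>This is cos 2t = 2 (cos t)^2 - 1, which turns the claim into
      \<open>c * c \<le> c\<close>.\<close>
    moreover have "Re (pairing \<xi> (x + x)) = 2 * (c * c) - 1"
      using c(2) by (simp add: pairing_add_right power2_eq_square flip: c_def)
    ultimately show ?thesis
      by (simp flip: c_def)
  qed
  \<comment> \<open>The induction must vary \<open>x\<close>, because the step uses the hypothesis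
    at \<open>x + x\<close>. As \<open>2 ^ n\<close> is unbounded, the defect then has to
    vanish.\<close>
  have bound: "2 ^ n * (1 - Re (pairing \<xi> x)) \<le> 1" for n x
  proof (induction n arbitrary: x)
    case 0
    show ?case
      using pos[of x] by simp
  next
    case (Suc n)
    have "2 ^ n * (2 * (1 - Re (pairing \<xi> x))) \<le> 2 ^ n * (1 - Re (pairing \<xi> (x + x)))"
      by (intro mult_left_mono double) simp
    then show ?case
      using Suc[of "x + x"] by (simp only: power_Suc mult.assoc mult.left_commute[of 2])
  qed
  have "pairing \<xi> x = 1" for x
  proof -
    have "Re (pairing \<xi> x) \<ge> 1"
    proof (rule ccontr)
      assume "\<not> ?thesis"
      then have e: "1 - Re (pairing \<xi> x) > 0"
        by simp
      obtain n where "1 / (1 - Re (pairing \<xi> x)) < 2 ^ n"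
        using real_arch_pow[of 2] by auto
      then show False
        using e bound[of n x] by (simp add: field_simps)
    qed
    moreover have "Re (pairing \<xi> x) \<le> 1"
      using complex_Re_le_cmod[of "pairing \<xi> x"] by simp
    ultimately show ?thesis
      using sq[of x] by (simp add: complex_eq_iff)
  qed
  then show ?thesis
    by (simp add: pairing_inject[symmetric] fun_eq_iff)
qed

lemma open_dual_Re_gt:
  assumes "compact K"
  shows "open {\<xi>. \<forall>x\<in>K. Re (pairing \<xi> x) > c}"
proof -
  have "{\<xi>. \<forall>x\<in>K. Re (pairing \<xi> x) > c} = {\<xi>. pairing \<xi> ` K \<subseteq> {z. Re z > c}}"
    by auto
  moreover have "open {z. Re z > c}"
    by (rule open_halfspace_Re_gt)
  ultimately have "{\<xi>. \<forall>x\<in>K. Re (pairing \<xi> x) > c} \<in>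
      {{\<xi>. pairing \<xi> ` K \<subseteq> U} | K U. compact K \<and> open U}"
    using assms by blast
  then show ?thesis
    unfolding open_dual_def by (rule generate_topology.Basis)
qed

text \<open>A character trivial on \<Gamma> takes all its values on a compact set \<open>K\<close>
  meeting every coset. If its real part is positive on \<open>K\<close>, it is positive everywhere,
  and the character is trivial. In the compact-open topology this condition on \<open>K\<close> is
  open.\<close>

lemma annihilator_isolated_zero:
  fixes \<Gamma> :: "'g :: topological_ab_group_add set"
  assumes "locally_compact_space (euclidean :: 'g topology)" "closed_subgroup \<Gamma>" "cocompact \<Gamma>"
  obtains V where "open V" and "0 \<in> V" and "annihilator \<Gamma> \<inter> V = {0}"
proof -
  obtain K where K: "compact K" "\<And>x. \<exists>k\<in>K. x - k \<in> \<Gamma>"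
    by (rule compact_transversal[OF assms]) blast
  let ?V = "{\<xi>. \<forall>x\<in>K. Re (pairing \<xi> x) > 0}"
  have "\<xi> = 0" if "\<xi> \<in> annihilator \<Gamma>" "\<xi> \<in> ?V" for \<xi>
  proof (rule dual_eq_zero_if_Re_pos)
    fix x
    obtain k where "k \<in> K" "x - k \<in> \<Gamma>"
      using K(2) by blast
    then have "pairing \<xi> x = pairing \<xi> k"
      using that(1) pairing_add_right[of \<xi> "x - k" k] by (simp add: annihilator_def)
    then show "Re (pairing \<xi> x) > 0"
      using that(2) \<open>k \<in> K\<close> by simp
  qed
  then have "annihilator \<Gamma> \<inter> ?V = {0}"
    by (auto simp: annihilator_def)
  then show thesis
    using open_dual_Re_gt[OF K(1)] by (intro that[of ?V]) auto
qed

section \<open>Compact sets of positive measure and the volume bound from Plancherel\<close>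

lemma integrable_indicator_compact:
  fixes \<mu> :: "'g :: {t2_space, ab_group_add} measure"
  assumes "haar_measure \<mu>" and "compact K"
  shows "integrable \<mu> (indicator K :: 'g \<Rightarrow> complex)"
proof -
  have "K \<in> sets \<mu>" "emeasure \<mu> K < \<infinity>"
    using assms compact_imp_closed[OF assms(2)] by (auto simp: haar_measure_def)
  then have "integrable \<mu> (indicator K :: 'g \<Rightarrow> real)"
    by (rule integrable_real_indicator)
  then have "integrable \<mu> (\<lambda>x. complex_of_real (indicator K x))"
    by (rule integrable_of_real)
  then show ?thesis
    by (simp add: of_real_indicator)
qed

text \<open>By the Lindelof property countably many compact sets cover the group. If all of them
  were null, so would be the group.\<close>

lemma haar_measure_compact_pos:
  fixes \<mu> :: "'g :: {topological_ab_group_add, t2_space, second_countable_topology} measure"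
  assumes lc: "locally_compact_space (euclidean :: 'g topology)" and "haar_measure \<mu>"
  obtains K where "compact K" and "0 < measure \<mu> K"
proof -
  have haar: "sets \<mu> = sets borel" "emeasure \<mu> UNIV \<noteq> 0"
    "\<And>K. compact K \<Longrightarrow> emeasure \<mu> K < \<infinity>"
    using assms(2) by (auto simp: haar_measure_def)
  have meas: "K \<in> sets \<mu>" if "compact K" for K
    using haar(1) compact_imp_closed[OF that] by (metis borel_closed)
  have "\<forall>x::'g. \<exists>U K. open U \<and> compact K \<and> x \<in> U \<and> U \<subseteq> K"
    using lc by (simp add: locally_compact_space_def)
  then obtain U K where UK: "\<And>x::'g. open (U x)" "\<And>x. compact (K x)" "\<And>x. x \<in> U x"
    "\<And>x. U x \<subseteq> K x"
    by metis
  obtain \<F> where \<F>: "\<F> \<subseteq> range U" "countable \<F>" "\<Union>\<F> = \<Union>(range U)"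
    by (rule Lindelof[of "range U"]) (use UK(1) in auto)
  then obtain X where X: "countable X" "\<F> = U ` X"
    using countable_subset_image[of \<F> U UNIV] by auto
  have cover: "(\<Union>x\<in>X. K x) = UNIV"
  proof -
    have "x \<in> (\<Union>x\<in>X. K x)" for x
    proof -
      have "x \<in> \<Union>\<F>"
        unfolding \<F>(3) using UK(3) by (rule UN_I[OF UNIV_I])
      then show ?thesis
        using X(2) UK(4) by auto
    qed
    then show ?thesis
      by auto
  qed
  have "\<exists>x\<in>X. emeasure \<mu> (K x) \<noteq> 0"
  proof (rule ccontr)
    assume "\<not> ?thesis"
    then have "(\<Union>x\<in>X. K x) \<in> null_sets \<mu>"
      using X(1) by (intro null_sets_UN') (auto simp: null_sets_def meas UK(2))
    then show False
      using haar(2) cover by auto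
  qed
  then obtain x where "emeasure \<mu> (K x) \<noteq> 0"
    by blast
  then have "0 < measure \<mu> (K x)"
    using haar(3)[OF UK(2)] by (simp add: measure_def enn2real_positive_iff top.not_eq_extremum zero_less_iff_neq_zero)
  then show thesis
    using that UK(2) by blast
qed

text \<open>A form of the uncertainty principle: every character near 1 on \<open>K\<close> makes
  the Fourier transform of the indicator of \<open>K\<close> large, while Plancherel fixes the L2
  norm of that transform.\<close>

lemma fourier_unitary_dual_volume:
  fixes \<mu> :: "'g :: {topological_ab_group_add, t2_space} measure"
  assumes \<mu>: "haar_measure \<mu>" and \<nu>: "haar_measure \<nu>" and F: "fourier_unitary \<mu> \<nu>"
    and K: "compact K" "0 < measure \<mu> K"
  obtains S where "S \<in> sets borel" and "{\<xi>. \<forall>x\<in>K. Re (pairing \<xi> x) > 1/2} \<subseteq> S"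
    and "emeasure \<nu> S \<le> ennreal (4 / measure \<mu> K)"
proof -
  define m where "m = measure \<mu> K"
  define f :: "'g \<Rightarrow> complex" where "f = indicator K"
  have sets: "sets \<mu> = sets borel" "sets \<nu> = sets borel"
    using \<mu> \<nu> by (auto simp: haar_measure_def)
  have K_meas: "K \<in> sets \<mu>"
    using sets(1) compact_imp_closed[OF K(1)] by (metis borel_closed)
  have fin: "emeasure \<mu> K < \<infinity>"
    using \<mu> K(1) by (auto simp: haar_measure_def)
  have f_int: "integrable \<mu> f"
    unfolding f_def using \<mu> K(1) by (rule integrable_indicator_compact)
  have f_sq: "(\<lambda>x. (cmod (f x))\<^sup>2) = indicator K"
    by (auto simp: f_def indicator_def)
  have "integrable \<mu> (\<lambda>x. (cmod (f x))\<^sup>2)"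
    unfolding f_sq using K_meas fin by (rule integrable_real_indicator)
  then have "square_integrable \<mu> f"
    using f_int by (simp add: square_integrable_def)
  then have sq: "square_integrable \<nu> (fourier \<mu> f)"
      and "(LINT \<xi>|\<nu>. (cmod (fourier \<mu> f \<xi>))\<^sup>2) = (LINT x|\<mu>. (cmod (f x))\<^sup>2)"
    using F f_int by (auto simp: fourier_unitary_def)
  then have norm: "(LINT \<xi>|\<nu>. (cmod (fourier \<mu> f \<xi>))\<^sup>2) = m"
    using K_meas by (simp add: f_sq m_def sets_eq_imp_space_eq[OF sets(1)])
  \<comment> \<open>A superlevel set of the squared modulus, as Markov's inequality requires. The
    level comes from integrating a real part above 1/2 over \<open>K\<close>.\<close>
  define S where "S = {\<xi> \<in> space \<nu>. (m/2)\<^sup>2 \<le> (cmod (fourier \<mu> f \<xi>))\<^sup>2}"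
  have sp: "space \<nu> = UNIV"
    using sets_eq_imp_space_eq[OF sets(2)] by simp
  show thesis
  proof
    have "(\<lambda>\<xi>. (cmod (fourier \<mu> f \<xi>))\<^sup>2) \<in> borel_measurable \<nu>"
      using sq by (auto simp: square_integrable_def)
    then have "S \<in> sets \<nu>"
      unfolding S_def by measurable
    then show "S \<in> sets borel"
      using sets(2) by simp
    show "{\<xi>. \<forall>x\<in>K. Re (pairing \<xi> x) > 1/2} \<subseteq> S"
    proof
      fix \<xi> assume "\<xi> \<in> {\<xi>. \<forall>x\<in>K. Re (pairing \<xi> x) > 1/2}"
      then have *: "Re (pairing \<xi> x) > 1/2" if "x \<in> K" for x
        using that by blast
      have pm: "pairing \<xi> \<in> borel_measurable \<mu>"
        using borel_measurable_continuous_onI[OF continuous_pairing] sets(1)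
        by (simp cong: measurable_cong_sets)
      have "(\<lambda>x. f x * cnj (pairing \<xi> x)) \<in> borel_measurable \<mu>"
        using f_int
        by (intro borel_measurable_times measurable_compose[OF pm] borel_measurable_continuous_onI
            continuous_intros) auto
      then have int: "integrable \<mu> (\<lambda>x. f x * cnj (pairing \<xi> x))"
        by (rule Bochner_Integration.integrable_bound[OF f_int]) (simp add: norm_mult)
      have "m / 2 = (LINT x|\<mu>. indicator K x / 2)"
        using K_meas by (simp add: m_def sets_eq_imp_space_eq[OF sets(1)])
      also have "\<dots> \<le> (LINT x|\<mu>. Re (f x * cnj (pairing \<xi> x)))"
        using * K_meas fin
        by (intro integral_mono integrable_divide integrable_real_indicator integrable_Re[OF int])
          (force simp: f_def indicator_def)+
      also have "\<dots> = Re (fourier \<mu> f \<xi>)"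
        using int by (simp only: integral_Re fourier_def)
      also have "\<dots> \<le> cmod (fourier \<mu> f \<xi>)"
        by (rule complex_Re_le_cmod)
      finally show "\<xi> \<in> S"
        using K(2) by (auto simp: S_def sp m_def intro: power_mono)
    qed
    \<comment> \<open>The integral equals \<open>m\<close>, so the bound is m / (m/2)^2 =
      4/m.\<close>
    have "emeasure \<nu> S \<le> ennreal (1 / (m/2)\<^sup>2 * (LINT \<xi>|\<nu>. (cmod (fourier \<mu> f \<xi>))\<^sup>2))"
      unfolding S_def using sq K(2)
      by (intro integral_Markov_inequality) (auto simp: square_integrable_def m_def)
    then show "emeasure \<nu> S \<le> ennreal (4 / measure \<mu> K)"
      using K(2) unfolding norm by (simp add: power2_eq_square flip: m_def)
  qed
qed

section \<open>Balls of the invariant metric\<close>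

lemma image_plus_mball:
  fixes d :: "'a :: {topological_space, ab_group_add} \<Rightarrow> 'a \<Rightarrow> real"
  assumes d: "proper_invariant_metric d"
  shows "(+) x ` Metric_space.mball UNIV d 0 t = Metric_space.mball UNIV d x t"
proof -
  interpret Metric_space UNIV d
    using d by (simp add: proper_invariant_metric_def)
  have "y \<in> mball x t \<longleftrightarrow> y - x \<in> mball 0 t" for y
  proof -
    have "d (x + 0) (x + (y - x)) = d 0 (y - x)"
      using d unfolding proper_invariant_metric_def by blast
    then show ?thesis
      by simp
  qed
  then show ?thesis
    by (force intro: image_eqI[of _ _ "_ - x"])
qed

text \<open>If one ball were null, so would be all its translates. Closed balls are compact, hence
  covered by finitely many translates, and the closed balls of integer radius exhaust the
  group.\<close>

lemma haar_measure_mball_pos: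
  fixes \<nu> :: "'a :: {topological_space, ab_group_add} measure"
  assumes \<nu>: "haar_measure \<nu>" and d: "proper_invariant_metric d" and t: "t > 0"
  shows "emeasure \<nu> (Metric_space.mball UNIV d 0 t) > 0"
proof (rule ccontr)
  interpret Metric_space UNIV d
    using d by (simp add: proper_invariant_metric_def)
  have top: "mtopology = euclidean" and inv: "\<And>\<xi> \<eta> \<zeta>. d (\<zeta> + \<xi>) (\<zeta> + \<eta>) = d \<xi> \<eta>"
    and cpt: "\<And>\<xi> r. compact (mcball \<xi> r)"
    using d by (auto simp: proper_invariant_metric_def)
  have opn: "open (mball x r)" for x r
    using openin_mball[of x r] by (simp add: top)
  have sets: "sets \<nu> = sets borel"
    using \<nu> by (simp add: haar_measure_def)
  assume "\<not> emeasure \<nu> (mball 0 t) > 0"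
  then have null: "mball x t \<in> null_sets \<nu>" for x
  proof -
    have "emeasure \<nu> ((+) x ` mball 0 t) = emeasure \<nu> (mball 0 t)"
      using \<nu> opn[of 0 t] by (simp add: haar_measure_def)
    then show ?thesis
      using \<open>\<not> _\<close> opn[of x t] by (simp add: null_sets_def sets image_plus_mball[OF d])
  qed
  have "mcball 0 (real n) \<subseteq> \<Union>(range (\<lambda>x. mball x t))" for n
    using t by auto
  then have "\<exists>X. finite X \<and> mcball 0 (real n) \<subseteq> (\<Union>x\<in>X. mball x t)" for n
    using compactE_image[OF cpt[of 0 "real n"], of UNIV "\<lambda>x. mball x t"] opn by metis
  then obtain X where X: "\<And>n. finite (X n)" "\<And>n. mcball 0 (real n) \<subseteq> (\<Union>x\<in>X n. mball x t)"
    by metis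
  have "(\<Union>n. \<Union>x\<in>X n. mball x t) \<in> null_sets \<nu>"
    using X(1) null by (intro null_sets_UN null_sets_UN') (auto intro: countable_finite)
  moreover have "(\<Union>n. \<Union>x\<in>X n. mball x t) = UNIV"
  proof -
    have "x \<in> (\<Union>n. \<Union>x\<in>X n. mball x t)" for x
    proof -
      obtain n where "d 0 x \<le> real n"
        using real_arch_simple by blast
      then have "x \<in> mcball 0 (real n)"
        by simp
      then show ?thesis
        by (intro UN_I[OF UNIV_I] subsetD[OF X(2)])
    qed
    then show ?thesis
      by auto
  qed
  ultimately show False
    using \<nu> by (auto simp: haar_measure_def)
qed

section \<open>Dual automorphisms\<close>

lemma group_aut_inv:
  assumes "a \<in> group_aut"
  shows "inv a \<in> group_aut"
proof -
  have a: "\<And>x y. a (x + y) = a x + a y" "bij a" "homeomorphism UNIV UNIV a (inv a)"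
    using assms by (auto simp: group_aut_def)
  have "inv a (x + y) = inv a x + inv a y" for x y
    using a(1)[of "inv a x" "inv a y"] a(2)
    by (metis bij_inv_eq_iff)
  then show ?thesis
    using a bij_imp_bij_inv[OF a(2)] a(3)[THEN homeomorphism_symD]
    by (simp add: group_aut_def inv_inv_eq)
qed

lemma dual_aut_inv:
  assumes "a \<in> group_aut"
  shows "dual_aut a (dual_aut (inv a) \<xi>) = \<xi>"
proof -
  have "bij a"
    using assms by (simp add: group_aut_def)
  then show ?thesis
    by (simp add: pairing_inject[symmetric] fun_eq_iff pairing_dual_aut assms group_aut_inv
        inv_inv_eq bij_is_surj surj_f_inv_f)
qed

lemma dual_aut_add:
  assumes "a \<in> group_aut"
  shows "dual_aut a (\<xi> + \<eta>) = dual_aut a \<xi> + dual_aut a \<eta>"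
  by (simp add: pairing_inject[symmetric] fun_eq_iff pairing_dual_aut assms pairing_plus)

section \<open>Counting annihilator points\<close>

text \<open>Since \<open>card\<close> of an infinite set is 0, finiteness has to be proved as well.
  A bound uniform over finite subsets yields both, so volumes need to be compared for finitely many
  balls only.\<close>

lemma finite_card_le_real:
  assumes "\<And>A. finite A \<Longrightarrow> A \<subseteq> B \<Longrightarrow> real (card A) \<le> c"
  shows "finite B \<and> real (card B) \<le> c"
proof -
  have "finite B"
  proof (rule ccontr)
    assume "infinite B"
    then obtain A where "finite A" "A \<subseteq> B" "card A = Suc (nat \<lfloor>c\<rfloor>)"
      using infinite_arbitrarily_large by blast
    then show False
      using assms[of A] by linarith
  qed
  then show ?thesis
    using assms by blast
qed

theorem theorem20:
  fixes \<mu> :: "'g :: {topological_ab_group_add, t2_space, second_countable_topology} measure"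
    and \<nu> :: "'g dual measure"
    and d :: "'g dual \<Rightarrow> 'g dual \<Rightarrow> real"
    and \<sigma> :: "'h :: topological_space measure"
    and \<alpha> :: "'h \<Rightarrow> 'g \<Rightarrow> 'g"
    and \<delta> l L :: "'h \<Rightarrow> real"
  assumes "locally_compact_space (euclidean :: 'g topology)"
    and "haar_measure \<mu>"
    and "haar_measure \<nu>"
    and "fourier_unitary \<mu> \<nu>"
    and "proper_invariant_metric d"
    and "weakly_doubling d \<nu>"
    and "sets \<sigma> = sets borel"
    and "sigma_finite_measure \<sigma>"
    and "\<forall>h. \<alpha> h \<in> group_aut"
    and "(\<lambda>(x, h). \<alpha> h x) \<in> measurable (\<mu> \<Otimes>\<^sub>M \<sigma>) borel"
    and "\<delta> \<in> borel_measurable \<sigma>"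
    and "\<forall>h. \<delta> h > 0"
    and "\<forall>h. \<forall>f :: 'g \<Rightarrow> complex. integrable \<mu> f \<longrightarrow>
           (LINT x|\<mu>. f (\<alpha> h x)) = complex_of_real (\<delta> h) * (LINT x|\<mu>. f x)"
    and "expanding \<sigma> d (\<lambda>h. dual_aut (\<alpha> h)) l L"
  shows "\<forall>\<Gamma>. closed_subgroup \<Gamma> \<and> cocompact \<Gamma> \<longrightarrow>
           property_X d (\<lambda>h. dual_aut (\<alpha> h)) \<delta> L (annihilator \<Gamma>)"
proof (intro allI impI)
  fix \<Gamma> :: "'g set"
  assume \<Gamma>: "closed_subgroup \<Gamma> \<and> cocompact \<Gamma>"
  interpret Metric_space UNIV d
    using assms(5) by (simp add: proper_invariant_metric_def)
  have top: "mtopology = euclidean" and inv: "\<And>\<xi> \<eta> \<zeta>. d (\<zeta> + \<xi>) (\<zeta> + \<eta>) = d \<xi> \<eta>"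
    and cpt: "\<And>\<xi> r. compact (mcball \<xi> r)"
    using assms(5) by (auto simp: proper_invariant_metric_def)
  have opn: "open (mball x r)" for x r
    using openin_mball[of x r] by (simp add: top)
  have nbhd: "\<exists>r>0. mball 0 r \<subseteq> V" if "open V" "0 \<in> V" for V
    using that openin_mtopology[of V] by (auto simp: top)
  have sub: "d (\<xi> + \<eta>) 0 \<le> d \<xi> 0 + d \<eta> 0" for \<xi> \<eta>
    using triangle[of "\<xi> + \<eta>" \<xi> 0] inv[of \<xi> \<eta> 0] by simp
  have d_diff: "d (\<xi> - \<eta>) 0 = d \<xi> \<eta>" for \<xi> \<eta>
    using inv[of \<eta> "\<xi> - \<eta>" 0] by simp
  have sets: "sets \<mu> = sets borel" "sets \<nu> = sets borel"
    using assms(2,3) by (auto simp: haar_measure_def)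

  obtain V where V: "open V" "0 \<in> V" "annihilator \<Gamma> \<inter> V = {0}"
    using annihilator_isolated_zero assms(1) \<Gamma> by metis
  obtain s where s: "s > 0" "mball 0 s \<subseteq> V"
    using nbhd[OF V(1,2)] by blast
  obtain K where K: "compact K" "0 < measure \<mu> K"
    by (rule haar_measure_compact_pos[OF assms(1,2)])
  obtain r' where r': "r' > 0" "mball 0 r' \<subseteq> {\<xi>. \<forall>x\<in>K. Re (pairing \<xi> x) > 1/2}"
    using nbhd[OF open_dual_Re_gt[OF K(1), of "1/2"]] by force
  \<comment> \<open>Halved so that the sum of two points of the ball of radius \<open>r\<close>
    stays in the ball of radius \<open>r'\<close>.\<close>
  define r where "r = r' / 2"
  have r: "r > 0"
    using r'(1) by (simp add: r_def)
  obtain M N where MN: "M > 0" "N > 0" "\<And>M' h. M' > M \<Longrightarrow> L h > M' \<Longrightarrow> l h > N"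
    using assms(14) unfolding expanding_def by metis
  have lip: "l h * d \<xi> 0 \<le> d (dual_aut (\<alpha> h) \<xi>) 0" for \<xi> h
    using assms(14) by (auto simp: expanding_def measurably_bi_lipschitz_def)
  \<comment> \<open>The bound \<open>s / 2\<close> makes balls around distinct annihilator points
    disjoint. The bound \<open>N * r\<close> makes the dual automorphism pull the ball of radius
    \<open>t\<close> back into the ball of radius \<open>r\<close> whenever
    \<open>l h > N\<close>.\<close>
  define t where "t = min (s / 2) (N * r)"
  have t: "t > 0" "t \<le> s / 2" "t \<le> N * r"
    using s(1) MN(2) r by (auto simp: t_def)
  define b where "b = measure \<nu> (mball 0 t)"
  have fin: "emeasure \<nu> (mball 0 t) < \<infinity>"
  proof -
    have "emeasure \<nu> (mball 0 t) \<le> emeasure \<nu> (mcball 0 t)"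
      by (rule emeasure_mono)
        (use closedin_mcball[of 0 t] in \<open>auto simp: sets top intro: borel_closed\<close>)
    also have "\<dots> < \<infinity>"
      using cpt assms(3) by (auto simp: haar_measure_def)
    finally show ?thesis .
  qed
  then have b: "emeasure \<nu> (mball 0 t) = ennreal b"
    by (simp add: b_def emeasure_eq_ennreal_measure top.not_eq_extremum)
  have b_pos: "b > 0"
    using haar_measure_mball_pos[OF assms(3,5) t(1)] by (simp add: b)

  let ?A = "\<lambda>h. annihilator \<Gamma> \<inter> dual_aut (\<alpha> h) ` mball 0 r"
  define C where "C = 4 / (measure \<mu> K * b)"
  \<comment> \<open>The expansion condition wants a threshold strictly above \<open>M\<close>, hence
    \<open>M + 1\<close>.\<close>
  have bound: "finite (?A h) \<and> real (card (?A h)) \<le> 1 + C * \<delta> h" if "L h > M + 1" for h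
  proof -
    have lN: "l h > N"
      using that by (intro MN(3)[of "M + 1"]) auto
    have aut: "\<alpha> h \<in> group_aut"
      using assms(9) by blast
    have a: "bij (\<alpha> h)" "continuous_on UNIV (\<alpha> h)"
      using aut by (auto simp: group_aut_def homeomorphism_def)
    define K' where "K' = \<alpha> h ` K"
    have K': "compact K'"
      unfolding K'_def using K(1) a(2) by (metis compact_continuous_image continuous_on_subset subset_UNIV)
    have "complex_of_real (measure \<mu> K) = complex_of_real (\<delta> h * measure \<mu> K')"
    proof -
      have sp: "space \<mu> = UNIV"
        using sets_eq_imp_space_eq[OF sets(1)] by simp
      \<comment> \<open>True for every \<open>X\<close>: if \<open>X\<close> is not measurable or
        has infinite measure, both sides are 0 by convention.\<close>
      have int: "(LINT x|\<mu>. indicator X x) = complex_of_real (measure \<mu> X)" for X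
        using sp integral_complex_of_real[of \<mu> "indicator X"] by (simp add: of_real_indicator)
      have "integrable \<mu> (indicator K' :: 'g \<Rightarrow> complex)"
        using assms(2) K' by (rule integrable_indicator_compact)
      then have "(LINT x|\<mu>. indicator K' (\<alpha> h x)) =
          complex_of_real (\<delta> h) * (LINT x|\<mu>. indicator K' x)"
        using assms(13) by blast
      moreover have "(\<lambda>x. indicator K' (\<alpha> h x) :: complex) = indicator K"
        using bij_is_inj[OF a(1)] by (auto simp: K'_def indicator_def inj_image_mem_iff)
      ultimately show ?thesis
        by (simp add: int)
    qed
    then have mK: "measure \<mu> K = \<delta> h * measure \<mu> K'"
      using of_real_eq_iff by blast
    have \<delta>: "\<delta> h > 0"
      using assms(12) by blast
    have K'_pos: "measure \<mu> K' > 0"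
      using K(2) \<delta> mK zero_less_mult_pos by metis
    obtain S where S: "S \<in> sets borel" "{\<xi>. \<forall>x\<in>K'. Re (pairing \<xi> x) > 1/2} \<subseteq> S"
      "emeasure \<nu> S \<le> ennreal (4 / measure \<mu> K')"
      by (rule fourier_unitary_dual_volume[OF assms(2-4) K' K'_pos])

    have in_S: "(+) \<kappa> ` mball 0 t \<subseteq> S" if \<kappa>: "\<kappa> \<in> dual_aut (\<alpha> h) ` mball 0 r" for \<kappa>
    proof
      fix \<xi> assume "\<xi> \<in> (+) \<kappa> ` mball 0 t"
      then obtain \<zeta> where \<zeta>: "\<xi> = \<kappa> + \<zeta>" "d \<zeta> 0 < t"
        by (auto simp: commute)
      obtain \<eta> where \<eta>: "\<kappa> = dual_aut (\<alpha> h) \<eta>" "d \<eta> 0 < r"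
        using \<kappa> by (auto simp: commute)
      define \<omega> where "\<omega> = dual_aut (inv (\<alpha> h)) \<zeta>"
      have \<omega>: "\<zeta> = dual_aut (\<alpha> h) \<omega>"
        using dual_aut_inv[OF aut] by (simp add: \<omega>_def)
      have "N * d \<omega> 0 \<le> l h * d \<omega> 0"
        using lN by (intro mult_right_mono) auto
      also have "\<dots> < N * r"
        using lip[of h \<omega>] \<zeta>(2) t(3) \<omega> by simp
      finally have "d \<omega> 0 < r"
        using MN(2) by simp
      then have "d (\<eta> + \<omega>) 0 < r'"
        using sub[of \<eta> \<omega>] \<eta>(2) by (simp add: r_def)
      then have pos: "\<forall>x\<in>K. Re (pairing (\<eta> + \<omega>) x) > 1/2"
        using r'(2) by (auto simp: commute subset_iff)
      have \<xi>: "\<xi> = dual_aut (\<alpha> h) (\<eta> + \<omega>)"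
        by (simp add: \<zeta>(1) \<eta>(1) \<omega> dual_aut_add[OF aut])
      have "\<forall>x\<in>K'. Re (pairing \<xi> x) > 1/2"
        using pos bij_is_inj[OF a(1)] by (auto simp: \<xi> pairing_dual_aut[OF aut] K'_def)
      then show "\<xi> \<in> S"
        using S(2) by blast
    qed

    \<comment> \<open>A common point would give a difference in the annihilator of norm below
      \<open>2 * t \<le> s\<close>, hence in \<open>V\<close>, where 0 is the only annihilator
      element.\<close>
    have disj: "(+) \<kappa> ` mball 0 t \<inter> (+) \<kappa>' ` mball 0 t = {}"
      if \<kappa>: "\<kappa> \<in> annihilator \<Gamma>" "\<kappa>' \<in> annihilator \<Gamma>" "\<kappa> \<noteq> \<kappa>'" for \<kappa> \<kappa>'
    proof (rule ccontr)
      assume "\<not> ?thesis"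
      then obtain \<zeta> \<zeta>' where \<zeta>: "\<kappa> + \<zeta> = \<kappa>' + \<zeta>'" "d 0 \<zeta> < t" "d 0 \<zeta>' < t"
        by auto
      have "\<kappa> - \<kappa>' = \<zeta>' - \<zeta>"
        using \<zeta>(1) by (simp add: algebra_simps)
      moreover have "d (\<zeta>' - \<zeta>) 0 < s"
        using triangle[of \<zeta>' 0 \<zeta>] commute[of \<zeta>' 0] \<zeta>(2,3) t(2) by (simp add: d_diff)
      ultimately have "\<kappa> - \<kappa>' \<in> V"
        using s(2) by (auto simp: commute)
      moreover have "\<kappa> - \<kappa>' \<in> annihilator \<Gamma>"
        using \<kappa>(1,2) by (simp add: annihilator_def minus_dual_def pairing_plus pairing_uminus
            del: add_uminus_conv_diff)
      ultimately have "\<kappa> - \<kappa>' = 0"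
        using V(3) by blast
      then show False
        using \<kappa>(3) by simp
    qed
    show "finite (?A h) \<and> real (card (?A h)) \<le> 1 + C * \<delta> h"
    proof (rule finite_card_le_real)
      fix A assume A: "finite A" "A \<subseteq> ?A h"
      have vol: "emeasure \<nu> ((+) \<kappa> ` mball 0 t) = ennreal b" for \<kappa>
        using assms(3) opn[of 0 t] b by (auto simp: haar_measure_def)
      have opn': "(+) \<kappa> ` mball 0 t \<in> sets \<nu>" for \<kappa>
        using opn[of \<kappa> t] by (simp add: sets image_plus_mball[OF assms(5)])
      have "ennreal (real (card A) * b) = (\<Sum>\<kappa>\<in>A. emeasure \<nu> ((+) \<kappa> ` mball 0 t))"
        using b_pos by (simp add: vol ennreal_mult ennreal_of_nat_eq_real_of_nat)
      also have "\<dots> = emeasure \<nu> (\<Union>\<kappa>\<in>A. (+) \<kappa> ` mball 0 t)"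
        using A disj opn' by (intro sum_emeasure) (auto simp: disjoint_family_on_def)
      also have "\<dots> \<le> emeasure \<nu> S"
      proof (rule emeasure_mono)
        show "(\<Union>\<kappa>\<in>A. (+) \<kappa> ` mball 0 t) \<subseteq> S"
          using A(2) by (intro UN_least in_S) blast
      qed (use S(1) in \<open>simp add: sets\<close>)
      also have "\<dots> \<le> ennreal (4 / measure \<mu> K')"
        by (rule S(3))
      finally have "real (card A) * b \<le> 4 / measure \<mu> K'"
        using K'_pos by (simp add: ennreal_le_iff)
      \<comment> \<open>Substituting \<open>measure \<mu> K = \<delta> h * measure \<mu> K'\<close>
        makes the constant independent of \<open>h\<close>.\<close>
      then have "real (card A) \<le> C * \<delta> h"
        using K'_pos b_pos \<delta> by (simp add: C_def mK field_simps)
      then show "real (card A) \<le> 1 + C * \<delta> h"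
        by simp
    qed
  qed
  have "C > 0"
    using K(2) b_pos by (simp add: C_def)
  moreover have "M + 1 > 0"
    using MN(1) by simp
  ultimately show "property_X d (\<lambda>h. dual_aut (\<alpha> h)) \<delta> L (annihilator \<Gamma>)"
    unfolding property_X_def using r bound by blast
qed

end
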